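(* Let $r\ge 1$, $m_0\ge m_1\ge\cdots\ge m_r\ge 1$, $A_0$ a real symmetric positive definite $m_0\times m_0$ matrix, and $B_k$ a real $m_{k-1}\times m_k$ matrix of rank $m_k$ for $k=1,\dots,r$. Let $A$, $B$, $E(t)=\exp(-tB^* )$, $\mathcal{C}(t)=\int_0^tE(s)AE^*(s)\,ds$ (a positive definite matrix for $t>0$) and the semigroup $(P_t)_{t\ge 0}$ on $\mathbb{R}^N=\mathbb{R}^{m_0}\times\cdots\times\mathbb{R}^{m_r}$ be the associated objects defined in the context. Let $f$ be a non-negative bounded Borel function on $\mathbb{R}^N$. Then for every $t>0$, $x,y\in\mathbb{R}^N$ and $\alpha>1$, $$(P_tf)^{\alpha}(x)\le C_\alpha(t,x,y)\,P_tf^{\alpha}(y),\qquad C_\alpha(t,x,y)=\exp\left(\frac{\alpha}{2(\alpha-1)}\left\langle\mathcal{C}^{-1}(t)(y-x),y-x\right\rangle\right).$$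
   Context: $N=\sum_{k=0}^rm_k$. In block form (block sizes $m_0,\dots,m_r$), $A=\begin{pmatrix}A_0&0\\0&0\end{pmatrix}$ is the $N\times N$ matrix with upper left block $A_0$ and zeros elsewhere, and $B$ is the $N\times N$ matrix whose $(k,k+1)$ block is $B_k$ for $1\le k\le r$ and all of whose other blocks are zero. $M^*$ denotes the transpose of a matrix $M$; $E^*(t)$ is the transpose of $E(t)$; $\mathcal{C}^{-1}(t)$ is the inverse matrix of $\mathcal{C}(t)$. $\langle\cdot,\cdot\rangle$ is the Euclidean inner product. $P_tf^\alpha$ means $P_t(f^\alpha)$. $P_t=e^{t\mathcal{L}}$ is the semigroup generated by $\mathcal{L}=\frac12\mathrm{div}(AD)+\langle x,BD\rangle$, $D=(\partial_{x_1},\dots,\partial_{x_N})$; explicitly, for $t>0$, $$P_tf(x)=\int_{\mathbb{R}^N}p(x-E(t)y,t)f(y)\,dy,\qquad p(x,t)=\frac{(2\pi)^{-N/2}}{\sqrt{\det\mathcal{C}(t)}}\exp\left(-\tfrac12\langle\mathcal{C}^{-1}(t)x,x\rangle\right).$$ *)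

theory Defs
  imports "HOL-Analysis.Analysis" "Jordan_Normal_Form.DL_Rank"
begin

text \<open>
  The given blocks, whose sizes vary with the block number, are matrices of type
  \<^typ>\<open>real Matrix.mat\<close> with explicit dimensions. The space of dimension
  \<open>N = m 0 + \<dots> + m r\<close> and the \<open>N \<times> N\<close> matrices acting on it have the type-indexed form
  \<open>real ^ 'n\<close> and \<open>real ^ 'n ^ 'n\<close>. The two are linked by a labelling of the coordinates by
  pairs (block number, position in the block).
\<close>

text \<open>
  Blocks are numbered from 0 here, so block \<open>k\<close> has size \<open>m k\<close>. The condition
  forces \<open>CARD('n) = (\<Sum>k\<le>r. m k)\<close>.
\<close>
definition block_labelling :: "nat \<Rightarrow> (nat \<Rightarrow> nat) \<Rightarrow> ('n::finite \<Rightarrow> nat \<times> nat) \<Rightarrow> bool" where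
  "block_labelling r m l \<longleftrightarrow> bij_betw l UNIV (SIGMA k:{..r}. {..<m k})"

definition sym_pos_def :: "nat \<Rightarrow> real Matrix.mat \<Rightarrow> bool" where
  "sym_pos_def n M \<longleftrightarrow> M \<in> carrier_mat n n \<and> transpose_mat M = M \<and>
     (\<forall>v \<in> carrier_vec n. v \<noteq> 0\<^sub>v n \<longrightarrow> scalar_prod v (M *\<^sub>v v) > 0)"

definition diffusion_matrix :: "('n::finite \<Rightarrow> nat \<times> nat) \<Rightarrow> real Matrix.mat \<Rightarrow> real ^ 'n ^ 'n" where
  "diffusion_matrix l A0 = (\<chi> i j. if fst (l i) = 0 \<and> fst (l j) = 0
     then A0 $$ (snd (l i), snd (l j)) else 0)"

text \<open>
  With blocks numbered from 0, \<open>Bs k\<close> (of size \<open>m (k - 1) \<times> m k\<close>, for \<open>1 \<le> k \<le> r\<close>) is the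
  block in block row \<open>k - 1\<close> and block column \<open>k\<close>.
\<close>
definition drift_matrix :: "('n::finite \<Rightarrow> nat \<times> nat) \<Rightarrow> (nat \<Rightarrow> real Matrix.mat) \<Rightarrow> real ^ 'n ^ 'n" where
  "drift_matrix l Bs = (\<chi> i j. if fst (l j) = Suc (fst (l i))
     then Bs (fst (l j)) $$ (snd (l i), snd (l j)) else 0)"

text \<open>
  The library's \<^const>\<open>exp\<close> is not available on \<open>real ^ 'n ^ 'n\<close>, whose \<open>*\<close> is
  the componentwise product; \<open>**\<close> is the matrix product.
\<close>
definition matrix_exp :: "real ^ 'n ^ 'n \<Rightarrow> real ^ 'n ^ ('n::finite)" where
  "matrix_exp M = (\<Sum>k. (1 / fact k) *\<^sub>R (((**) M ^^ k) (Finite_Cartesian_Product.mat 1)))"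

definition flow_matrix :: "real ^ 'n ^ 'n \<Rightarrow> real \<Rightarrow> real ^ 'n ^ ('n::finite)" where
  "flow_matrix B t = matrix_exp ((- t) *\<^sub>R transpose B)"

definition cov_matrix :: "real ^ 'n ^ 'n \<Rightarrow> real ^ 'n ^ 'n \<Rightarrow> real \<Rightarrow> real ^ 'n ^ ('n::finite)" where
  "cov_matrix A B t =
     integral {0..t} (\<lambda>s. flow_matrix B s ** A ** transpose (flow_matrix B s))"

definition gauss_kernel ::
  "real ^ 'n ^ 'n \<Rightarrow> real ^ 'n ^ 'n \<Rightarrow> real ^ ('n::finite) \<Rightarrow> real \<Rightarrow> real" where
  "gauss_kernel A B x t =
     (2 * pi) powr (- (real CARD('n) / 2)) / sqrt (Determinants.det (cov_matrix A B t)) *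
     exp (- (1 / 2) * inner (matrix_inv (cov_matrix A B t) *v x) x)"

text \<open>
  The semigroup generated by \<open>div (A D) / 2 + \<langle>x, B D\<rangle>\<close>, through its integral
  representation; meaningful for \<open>t > 0\<close> only.
\<close>
definition semigroup_op ::
  "real ^ 'n ^ 'n \<Rightarrow> real ^ 'n ^ 'n \<Rightarrow> real \<Rightarrow> (real ^ 'n \<Rightarrow> real) \<Rightarrow> real ^ ('n::finite) \<Rightarrow> real" where
  "semigroup_op A B t f x = (LINT y|lborel. gauss_kernel A B (x - flow_matrix B t *v y) t * f y)"

end

theory Submission
  imports Defs "HOL-Probability.Distributions"
begin

text \<open>
  Writing \<open>p\<^sub>x(z) = p(x - E(t) z, t)\<close>, so that \<open>P\<^sub>t f(x)\<close> is the integral of \<open>p\<^sub>x f\<close>, the idea is to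
  transfer the mass from \<open>x\<close> to \<open>y\<close> inside the integral: \<open>p\<^sub>x f\<close> is the product of
  \<open>p\<^sub>y\<close> to the power \<open>1/\<alpha>\<close> times \<open>f\<close>, and of \<open>p\<^sub>x\<close> times \<open>p\<^sub>y\<close> to the power \<open>-1/\<alpha>\<close>.
  Hoelder's inequality with exponents \<open>\<alpha>\<close> and \<open>q = \<alpha>/(\<alpha>-1)\<close> produces exactly
  \<open>P\<^sub>t f\<^sup>\<alpha>(y)\<close> from the first factor, while the second one, raised to the power \<open>q\<close>, is
  \<open>p\<^sub>x\<close> to the power \<open>q\<close> times \<open>p\<^sub>y\<close> to the power \<open>1 - q\<close>. The weights \<open>q\<close> and \<open>1 - q\<close> sum to 1, so
  completing the square turns this into the kernel centred at \<open>q x + (1 - q) y\<close> times the constant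
  \<open>exp (q (q - 1) / 2 \<langle>C\<^sup>-\<^sup>1(t)(y - x), y - x\<rangle>)\<close> (lemma \<open>gauss_kernel_powr_interpolation\<close>). Since
  the kernel has total mass 1 in \<open>z\<close>, only that constant survives the integration; raised
  to the power \<open>\<alpha>/q = \<alpha> - 1\<close> it is \<open>C\<^sub>\<alpha>(t,x,y)\<close>.

  The mass of the kernel is a Gaussian integral combined with the substitution by \<open>E(t)\<close>
  (\<open>gauss_kernel_integral_eq_1\<close>). It equals 1 because \<open>B\<^sup>*\<close> maps each block of coordinates to the
  next one: hence \<open>E(t)\<close> is unitriangular with respect to the block number and
  has determinant 1 (\<open>det_flow_matrix_drift\<close>). The Gaussian integral itself is computed for an arbitrary
  symmetric positive definite \<open>M\<close> by substituting a matrix whose columns are orthonormal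
  for the inner product given by \<open>M\<close>. The linear change of variables is reduced to elementary
  matrices; the essential case is a shear, which is treated by Fubini.

  The covariance matrix is an integral of matrices of the form \<open>E A E\<^sup>*\<close>, hence symmetric and
  positive semidefinite, and positive definite as soon as it is nonsingular. Should its determinant vanish, the
  kernel would be the zero function, as \<open>1 / 0 = 0\<close>, and both sides of the inequality would be 0.
\<close>

no_notation vec_index (infixl "$" 100)
hide_const (open) Matrix.mat Matrix.row Determinant.det
hide_fact (open) Matrix.mat_def Matrix.row_def Matrix.vec_eq_iff

section \<open>Linear change of variables for Lebesgue measure\<close>

text \<open>
  This is the change of variables formula as a predicate on matrices, in a form suited to an induction
  over products of elementary matrices. Singular matrices are let in vacuously: they may occur among
  the generators, but never as a factor of a nonsingular product.
\<close>

definition scales_lborel :: "real ^ 'n ^ 'n::finite \<Rightarrow> bool" where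
  "scales_lborel L \<longleftrightarrow> (det L \<noteq> 0 \<longrightarrow> (\<forall>g. g \<in> borel_measurable borel \<longrightarrow>
     (\<integral>\<^sup>+x. g x \<partial>lborel) = ennreal \<bar>det L\<bar> * (\<integral>\<^sup>+x. g (L *v x) \<partial>lborel)))"

lemma borel_measurable_matrix_vector_mult [measurable]:
  "((*v) (L :: real ^ 'n ^ 'm)) \<in> borel_measurable borel"
  by (intro borel_measurable_continuous_onI) (simp add: linear_continuous_on)

lemma Basis_vec_real: "(Basis :: (real ^ 'n) set) = range (\<lambda>i. axis i 1)"
  by (auto simp: Basis_vec_def)

lemma inj_axis_1: "inj (\<lambda>i::'n::finite. axis i (1::real))"
  by (auto simp: inj_on_def axis_eq_axis)

lemma sum_Basis_vec: "(\<Sum>b\<in>(Basis :: (real ^ 'n) set). h b) = (\<Sum>i\<in>UNIV. h (axis i 1))"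
  by (simp add: Basis_vec_real sum.reindex inj_axis_1)

lemma prod_Basis_vec: "(\<Prod>b\<in>(Basis :: (real ^ 'n) set). h b) = (\<Prod>i\<in>UNIV. h (axis i 1))"
  by (simp add: Basis_vec_real prod.reindex inj_axis_1)

lemma scales_lborel_mult:
  fixes A B :: "real ^ 'n ^ 'n"
  assumes "scales_lborel A" "scales_lborel B"
  shows "scales_lborel (A ** B)"
  unfolding scales_lborel_def
proof (intro impI allI)
  fix g :: "real ^ 'n \<Rightarrow> ennreal"
  assume d: "det (A ** B) \<noteq> 0" and [measurable]: "g \<in> borel_measurable borel"
  have dA: "det A \<noteq> 0" and dB: "det B \<noteq> 0" using d by (auto simp: det_mul)
  have 1: "(\<integral>\<^sup>+x. g x \<partial>lborel) = ennreal \<bar>det A\<bar> * (\<integral>\<^sup>+x. g (A *v x) \<partial>lborel)"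
    using assms(1) dA \<open>g \<in> _\<close> unfolding scales_lborel_def by blast
  have "(\<lambda>x. g (A *v x)) \<in> borel_measurable borel" by measurable
  then have 2: "(\<integral>\<^sup>+x. g (A *v x) \<partial>lborel) = ennreal \<bar>det B\<bar> * (\<integral>\<^sup>+x. g (A *v (B *v x)) \<partial>lborel)"
    using assms(2) dB unfolding scales_lborel_def by blast
  show "(\<integral>\<^sup>+x. g x \<partial>lborel) = ennreal \<bar>det (A ** B)\<bar> * (\<integral>\<^sup>+x. g (A ** B *v x) \<partial>lborel)"
    unfolding 1 2 by (simp add: det_mul abs_mult ennreal_mult matrix_vector_mul_assoc mult.assoc)
qed

lemma scales_lborel_diagonal:
  fixes A :: "real ^ 'n ^ 'n"
  assumes off: "\<And>i j. i \<noteq> j \<Longrightarrow> A $ i $ j = 0"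
  shows "scales_lborel A"
  unfolding scales_lborel_def
proof (intro impI allI)
  fix g :: "real ^ 'n \<Rightarrow> ennreal"
  assume d: "det A \<noteq> 0" and [measurable]: "g \<in> borel_measurable borel"
  have dA: "det A = (\<Prod>i\<in>UNIV. A $ i $ i)"
    using off by (rule det_diagonal)
  define c :: "real ^ 'n \<Rightarrow> real" where "c = (\<lambda>b. inner (A *v b) b)"
  have c: "c (axis i 1) = A $ i $ i" for i
    by (simp add: c_def inner_axis matrix_vector_mult_basis column_def)
  have "0 + (\<Sum>j\<in>Basis. (c j * inner x j) *\<^sub>R j) = A *v x" for x
  proof -
    have "(A *v x) $ i = A $ i $ i * x $ i" for i
      using off by (simp add: matrix_vector_mult_def sum.remove[of UNIV i])
    then show ?thesis
      unfolding sum_Basis_vec c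
      by (simp add: vec_eq_iff inner_axis) (simp add: axis_def if_distrib cong: if_cong)
  qed
  then have "lborel = density (distr lborel borel ((*v) A)) (\<lambda>_. ennreal (\<Prod>j\<in>Basis. \<bar>c j\<bar>))"
  proof -
    assume eq: "\<And>x. 0 + (\<Sum>j\<in>Basis. (c j * inner x j) *\<^sub>R j) = A *v x"
    have "c j \<noteq> 0" if "j \<in> Basis" for j
      using that d by (auto simp: Basis_vec_real c dA)
    from lborel_affine_euclidean[of c 0, OF this] show ?thesis
      unfolding eq by simp
  qed
  moreover have "(\<Prod>j\<in>Basis. \<bar>c j\<bar>) = \<bar>det A\<bar>"
    unfolding prod_Basis_vec c dA by (simp add: abs_prod)
  ultimately have "lborel = density (distr lborel borel ((*v) A)) (\<lambda>_. \<bar>det A\<bar>)" by simp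
  then have "(\<integral>\<^sup>+x. g x \<partial>lborel) = (\<integral>\<^sup>+x. g x \<partial>density (distr lborel borel ((*v) A)) (\<lambda>_. \<bar>det A\<bar>))"
    by simp
  also have "\<dots> = ennreal \<bar>det A\<bar> * (\<integral>\<^sup>+x. g (A *v x) \<partial>lborel)"
    by (simp add: nn_integral_density nn_integral_distr nn_integral_cmult)
  finally show "(\<integral>\<^sup>+x. g x \<partial>lborel) = ennreal \<bar>det A\<bar> * (\<integral>\<^sup>+x. g (A *v x) \<partial>lborel)" .
qed

lemma scales_lborel_swap:
  fixes m n :: "'n::finite"
  assumes "m \<noteq> n"
  shows "scales_lborel (\<chi> i j. mat 1 $ i $ Transposition.transpose m n j)" (is "scales_lborel ?A")
  unfolding scales_lborel_def
proof (intro impI allI)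
  fix g :: "real ^ 'n \<Rightarrow> ennreal"
  assume [measurable]: "g \<in> borel_measurable borel"
  let ?s = "Transposition.transpose m n"
  have s: "?s permutes UNIV" by (simp add: permutes_swap_id)
  have "det ?A = of_int (sign ?s) * det (mat 1 :: real ^ 'n ^ 'n)"
    by (rule det_permute_columns[OF s])
  then have d: "\<bar>det ?A\<bar> = 1" by (simp add: sign_swap_id assms)
  have A: "(?A *v x) $ i = x $ ?s i" for x :: "real ^ 'n" and i
  proof -
    have "mat 1 $ i $ ?s j = (if j = ?s i then 1 else 0 :: real)" for j
      by (auto simp: mat_def)
    then show ?thesis
      by (simp add: matrix_vector_mult_def if_distrib[of "\<lambda>a. a * _"] cong: if_cong)
  qed
  have v: "(?A *v x \<in> box l u) \<longleftrightarrow> x \<in> box (\<chi> i. l $ ?s i) (\<chi> i. u $ ?s i)" for x l u :: "real ^ 'n"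
    unfolding mem_box_cart A vec_lambda_beta
    by (metis transpose_involutory)
  have "lborel = distr lborel borel ((*v) ?A)"
  proof (rule lborel_eqI)
    fix l u :: "real ^ 'n"
    assume le: "\<And>b. b \<in> Basis \<Longrightarrow> inner l b \<le> inner u b"
    have le': "l $ i \<le> u $ i" for i
      using le[of "axis i 1"] by (simp add: inner_axis)
    have "emeasure (distr lborel borel ((*v) ?A)) (box l u)
        = emeasure lborel (box (\<chi> i. l $ ?s i) (\<chi> i. u $ ?s i))"
      using v[of _ l u] by (subst emeasure_distr) (auto simp: vimage_def)
    also have "\<dots> = (\<Prod>i\<in>UNIV. u $ ?s i - l $ ?s i)"
      using le' by (subst emeasure_lborel_box) (auto simp: Basis_vec_real inner_axis prod.reindex inj_axis_1)
    also have "(\<Prod>i\<in>UNIV. u $ ?s i - l $ ?s i) = (\<Prod>i\<in>UNIV. u $ i - l $ i)"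
      using prod.permute[OF s, of "\<lambda>i. u $ i - l $ i"] by (simp add: o_def)
    finally show "emeasure (distr lborel borel ((*v) ?A)) (box l u) = (\<Prod>b\<in>Basis. inner (u - l) b)"
      by (simp add: prod_Basis_vec inner_axis)
  qed simp
  then have "(\<integral>\<^sup>+x. g x \<partial>lborel) = (\<integral>\<^sup>+x. g x \<partial>distr lborel borel ((*v) ?A))" by simp
  also have "\<dots> = (\<integral>\<^sup>+x. g (?A *v x) \<partial>lborel)"
    by (subst nn_integral_distr) auto
  finally show "(\<integral>\<^sup>+x. g x \<partial>lborel) = ennreal \<bar>det ?A\<bar> * (\<integral>\<^sup>+x. g (?A *v x) \<partial>lborel)"
    by (simp only: d) simp
qed

text \<open>
  A shear translates one coordinate by an amount that depends only on the others, so Fubini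
  reduces the claim to translation invariance of the measure on the line.
\<close>

lemma scales_lborel_shear:
  fixes m n :: "'n::finite"
  assumes mn: "m \<noteq> n"
  shows "scales_lborel (\<chi> i j. if i = m \<and> j = n then c else of_bool (i = j))" (is "scales_lborel ?A")
  unfolding scales_lborel_def
proof (intro impI allI)
  fix g :: "real ^ 'n \<Rightarrow> ennreal"
  assume [measurable]: "g \<in> borel_measurable borel"
  have "?A = (\<chi> k. if k = m then row m (mat 1) + c *s row n (mat 1) else row k (mat 1))"
    using mn by (auto simp: vec_eq_iff row_def mat_def)
  then have d: "det ?A = 1"
    by (simp only: det_row_operation[OF mn] det_I)
  have A: "?A *v x = x + axis m (c * x $ n)" for x :: "real ^ 'n"
  proof -
    have "(if i = m \<and> j = n then c else of_bool (i = j)) * x $ j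
       = (if i = j then x $ j else 0) + (if j = n then (if i = m then c * x $ n else 0) else 0)" for i j
      using mn by auto
    then show ?thesis
      by (simp add: vec_eq_iff matrix_vector_mult_def sum.distrib axis_def)
  qed
  interpret product_sigma_finite "\<lambda>b::real ^ 'n. lborel :: real measure" ..
  \<comment> \<open>Lebesgue measure is split into the coordinate \<open>m\<close> that is moved and the remaining ones, \<open>B\<close>.\<close>
  define B :: "(real ^ 'n) set" where "B = Basis - {axis m 1}"
  have B: "Basis = insert (axis m 1) B" "axis m 1 \<notin> B" "finite B" and nB: "axis n 1 \<in> B"
    using mn by (auto simp: B_def Basis_vec_real axis_eq_axis)
  let ?P = "PiM (insert (axis m (1::real)) B) (\<lambda>_. lborel :: real measure)"
  define \<Phi> where "\<Phi> f = (\<Sum>b\<in>Basis. f b *\<^sub>R b)" for f :: "real ^ 'n \<Rightarrow> real"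
  have [measurable]: "\<Phi> \<in> borel_measurable ?P"
    unfolding \<Phi>_def B(1) by measurable
  have lb: "lborel = distr ?P borel \<Phi>"
    using lborel_eq[where 'a = "real ^ 'n"] B(1) unfolding \<Phi>_def by simp
  have \<Phi>n: "\<Phi> f $ n = f (axis n 1)" for f
    unfolding \<Phi>_def sum_Basis_vec by (simp add: axis_def if_distrib cong: if_cong)
  have \<Phi>upd: "\<Phi> (f(axis m 1 := y)) = y *\<^sub>R axis m 1 + (\<Sum>b\<in>B. f b *\<^sub>R b)" for f y
  proof -
    have "(\<Sum>b\<in>B. (f(axis m 1 := y)) b *\<^sub>R b) = (\<Sum>b\<in>B. f b *\<^sub>R b)"
      using B(2) by (intro sum.cong) auto
    then show ?thesis using B(2,3) by (simp add: \<Phi>_def B(1))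
  qed
  have "(\<integral>\<^sup>+x. g (?A *v x) \<partial>lborel) = (\<integral>\<^sup>+f. g (?A *v \<Phi> f) \<partial>?P)"
    unfolding lb by (rule nn_integral_distr) measurable
  also have "\<dots> = (\<integral>\<^sup>+f. \<integral>\<^sup>+y. g (?A *v \<Phi> (f(axis m 1 := y))) \<partial>lborel \<partial>PiM B (\<lambda>_. lborel))"
    by (rule product_nn_integral_insert[OF B(3,2)]) measurable
  also have "\<dots> = (\<integral>\<^sup>+f. \<integral>\<^sup>+y. g (\<Phi> (f(axis m 1 := y))) \<partial>lborel \<partial>PiM B (\<lambda>_. lborel))"
  proof (rule nn_integral_cong)
    fix f
    let ?h = "\<lambda>y. g (y *\<^sub>R axis m 1 + (\<Sum>b\<in>B. f b *\<^sub>R b))"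
    have "?A *v \<Phi> (f(axis m 1 := y)) = (c * f (axis n 1) + 1 * y) *\<^sub>R axis m 1 + (\<Sum>b\<in>B. f b *\<^sub>R b)" for y
      unfolding A \<Phi>n using mn by (simp add: \<Phi>upd axis_eq_axis) (simp add: vec_eq_iff axis_def algebra_simps)
    then show "(\<integral>\<^sup>+y. g (?A *v \<Phi> (f(axis m 1 := y))) \<partial>lborel) = (\<integral>\<^sup>+y. g (\<Phi> (f(axis m 1 := y))) \<partial>lborel)"
      using nn_integral_real_affine[of ?h 1 "c * f (axis n 1)"] by (simp add: \<Phi>upd)
  qed
  also have "\<dots> = (\<integral>\<^sup>+f. g (\<Phi> f) \<partial>?P)"
    by (rule product_nn_integral_insert[OF B(3,2), symmetric]) measurable
  also have "\<dots> = (\<integral>\<^sup>+x. g x \<partial>lborel)"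
    unfolding lb by (rule nn_integral_distr[symmetric]) measurable
  finally show "(\<integral>\<^sup>+x. g x \<partial>lborel) = ennreal \<bar>det ?A\<bar> * (\<integral>\<^sup>+x. g (?A *v x) \<partial>lborel)"
    by (simp only: d) simp
qed

lemma nn_integral_lborel_matrix_substitution:
  fixes L :: "real ^ 'n ^ 'n" and g :: "real ^ 'n \<Rightarrow> ennreal"
  assumes "g \<in> borel_measurable borel" and "det L \<noteq> 0"
  shows "(\<integral>\<^sup>+x. g x \<partial>lborel) = ennreal \<bar>det L\<bar> * (\<integral>\<^sup>+x. g (L *v x) \<partial>lborel)"
proof -
  have "scales_lborel L"
  proof (rule induct_matrix_elementary)
    show "scales_lborel A" if "row i A = 0" for A :: "real ^ 'n ^ 'n" and i
      using det_zero_row(2)[OF that] by (simp add: scales_lborel_def)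
  qed (rule scales_lborel_mult scales_lborel_diagonal scales_lborel_swap scales_lborel_shear; assumption)+
  then show ?thesis using assms unfolding scales_lborel_def by blast
qed

section \<open>Positive definite matrices\<close>

lemma inner_matrix_vector_mult_left:
  fixes M :: "real ^ 'n ^ 'm"
  shows "inner (M *v u) v = inner u (transpose M *v v)"
  by (metis dot_lmul_matrix inner_commute transpose_matrix_vector transpose_transpose)

definition pos_def :: "real ^ 'n ^ 'n \<Rightarrow> bool" where
  "pos_def M \<longleftrightarrow> transpose M = M \<and> (\<forall>u. u \<noteq> 0 \<longrightarrow> inner (M *v u) u > 0)"

definition pos_semidef :: "real ^ 'n ^ 'n \<Rightarrow> bool" where
  "pos_semidef M \<longleftrightarrow> transpose M = M \<and> (\<forall>u. inner (M *v u) u \<ge> 0)"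

text \<open>
  Gram-Schmidt for the inner product \<open>\<langle>M u, v\<rangle>\<close>: fewer than \<open>N\<close> vectors \<open>M b\<^sub>i\<close> cannot span the space,
  so some nonzero vector is orthogonal to all of them in the usual sense, and can be normalised.
  The family is indexed by subsets of the index type itself, so that the full
  set gives the columns of a square matrix.
\<close>

lemma pos_def_orthonormal_family:
  fixes M :: "real ^ 'n ^ 'n" and J :: "'n set"
  assumes M: "pos_def M"
  shows "\<exists>b :: 'n \<Rightarrow> real ^ 'n. \<forall>i\<in>J. \<forall>j\<in>J. inner (M *v b i) (b j) = of_bool (i = j)"
  using finite[of J]
proof (induction J rule: finite_induct)
  case (insert k J)
  then obtain b :: "'n \<Rightarrow> real ^ 'n"
    where b: "\<And>i j. i \<in> J \<Longrightarrow> j \<in> J \<Longrightarrow> inner (M *v b i) (b j) = of_bool (i = j)"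
    by blast
  have "J \<noteq> UNIV" using insert.hyps(2) by auto
  then have "card J < CARD('n)" by (simp add: psubset_card_mono psubset_eq)
  then have "dim ((\<lambda>i. M *v b i) ` J) < DIM(real ^ 'n)"
    using dim_le_card'[of "(\<lambda>i. M *v b i) ` J"] card_image_le[OF insert.hyps(1), of "\<lambda>i. M *v b i"]
      insert.hyps(1) by simp
  then obtain x where x: "x \<noteq> 0" and orth: "\<And>y. y \<in> span ((\<lambda>i. M *v b i) ` J) \<Longrightarrow> Linear_Algebra.orthogonal x y"
    using orthogonal_to_subspace_exists by blast
  define q where "q = inner (M *v x) x"
  have q: "q > 0" using M x by (simp add: pos_def_def q_def)
  define v where "v = (1 / sqrt q) *\<^sub>R x"
  have vv: "inner (M *v v) v = 1"
    using q by (simp add: v_def matrix_vector_mult_scaleR q_def[symmetric])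
  have bv: "inner (M *v b i) v = 0" if "i \<in> J" for i
    using orth[of "M *v b i"] that by (simp add: v_def span_base Linear_Algebra.orthogonal_def inner_commute)
  have vb: "inner (M *v v) (b i) = 0" if "i \<in> J" for i
    using bv[OF that] M
    by (subst inner_matrix_vector_mult_left) (simp add: pos_def_def inner_commute)
  have "\<forall>i\<in>insert k J. \<forall>j\<in>insert k J.
      inner (M *v (b(k := v)) i) ((b(k := v)) j) = of_bool (i = j)"
    using b bv vb vv insert.hyps(2) by auto
  then show ?case by blast
qed simp

lemma pos_def_whitening:
  fixes M :: "real ^ 'n ^ 'n"
  assumes "pos_def M"
  obtains S :: "real ^ 'n ^ 'n" where "transpose S ** M ** S = mat 1"
proof -
  obtain b :: "'n \<Rightarrow> real ^ 'n" where b: "\<And>i j. inner (M *v b i) (b j) = of_bool (i = j)"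
    using pos_def_orthonormal_family[OF assms, of UNIV] by auto
  define S :: "real ^ 'n ^ 'n" where "S = (\<chi> i j. b j $ i)"
  have "(transpose S ** M ** S) $ i $ j = inner (M *v b j) (b i)" for i j
  proof -
    have "(transpose S ** (M ** S)) $ i $ j = (\<Sum>k\<in>UNIV. b i $ k * (M *v b j) $ k)"
      by (simp add: matrix_matrix_mult_def S_def transpose_def matrix_vector_mult_def)
    then show ?thesis
      by (simp add: matrix_mul_assoc inner_vec_def mult.commute)
  qed
  then have "transpose S ** M ** S = mat 1"
    by (auto simp: vec_eq_iff b mat_def)
  then show ?thesis by (rule that)
qed

text \<open>
  Where a positive semidefinite quadratic form vanishes it has a minimum, so its gradient \<open>2 C v\<close> is
  zero there; nonsingularity then gives \<open>v = 0\<close>.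
\<close>

lemma pos_semidef_nonsingular_imp_pos_def:
  fixes C :: "real ^ 'n ^ 'n"
  assumes C: "pos_semidef C" and d: "det C \<noteq> 0"
  shows "pos_def C"
proof -
  have sym: "transpose C = C" and nn: "inner (C *v u) u \<ge> 0" for u
    using C by (auto simp: pos_semidef_def)
  have "inner (C *v v) v > 0" if v: "v \<noteq> 0" for v
  proof (rule ccontr)
    assume "\<not> inner (C *v v) v > 0"
    then have z: "inner (C *v v) v = 0" using nn[of v] by simp
    define w where "w = C *v v"
    define n where "n = inner w w"
    define q where "q = inner (C *v w) w"
    \<comment> \<open>Along \<open>v + s w\<close> the form is \<open>2 s n + s\<^sup>2 q\<close>, which is negative for this \<open>s\<close>.
      The added 1 keeps the denominator positive when \<open>q = 0\<close>.\<close>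
    define s where "s = - n / (q + 1)"
    have "w \<noteq> 0"
      using v d unfolding w_def
      by (metis invertible_det_nz inj_matrix_vector_mult injD matrix_vector_mult_0_right)
    then have n: "n > 0" by (simp add: n_def)
    have q: "q \<ge> 0" by (simp add: q_def nn)
    have wv: "inner (C *v w) v = n"
      by (simp add: inner_matrix_vector_mult_left sym n_def w_def)
    have "0 \<le> inner (C *v (v + s *\<^sub>R w)) (v + s *\<^sub>R w)" by (rule nn)
    also have "\<dots> = 2 * s * n + s\<^sup>2 * q"
      using z wv
      by (simp add: matrix_vector_right_distrib matrix_vector_mult_scaleR inner_add_left inner_add_right
          w_def[symmetric] n_def[symmetric] q_def[symmetric] power2_eq_square algebra_simps)
    also have "\<dots> = - (n\<^sup>2 * (q + 2)) / (q + 1)\<^sup>2"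
      using q by (simp add: s_def power2_eq_square divide_simps) (simp add: algebra_simps)
    also have "\<dots> < 0" using n q by (simp add: divide_neg_pos)
    finally show False by simp
  qed
  then show ?thesis using sym by (simp add: pos_def_def)
qed

section \<open>Gaussian integrals\<close>

lemma nn_integral_std_gaussian_real:
  "(\<integral>\<^sup>+(x::real). ennreal (exp (- (1 / 2) * x\<^sup>2)) \<partial>lborel) = ennreal (sqrt (2 * pi))"
proof -
  interpret prob_space "density lborel (\<lambda>x. ennreal (std_normal_density x))"
    by (rule prob_space_normal_density) simp
  have "(\<integral>\<^sup>+x. ennreal (std_normal_density x) \<partial>lborel) = 1"
    using emeasure_space_1 by (simp add: emeasure_density)
  moreover have "ennreal (exp (- (1 / 2) * x\<^sup>2)) = ennreal (sqrt (2 * pi)) * ennreal (std_normal_density x)"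
    for x :: real
    unfolding std_normal_density_def by (subst ennreal_mult[symmetric]) auto
  ultimately show ?thesis
    by (simp add: nn_integral_cmult)
qed

lemma nn_integral_std_gaussian:
  "(\<integral>\<^sup>+(x::real ^ 'n). ennreal (exp (- (1 / 2) * inner x x)) \<partial>lborel)
    = ennreal ((2 * pi) powr (real CARD('n) / 2))"
proof -
  have "ennreal (exp (- (1 / 2) * inner x x)) = (\<Prod>b\<in>Basis. ennreal (exp (- (1 / 2) * (inner x b)\<^sup>2)))"
    for x :: "real ^ 'n"
    by (simp add: prod_ennreal exp_sum[symmetric] euclidean_inner[of x x] power2_eq_square
        sum_distrib_left sum_negf[symmetric] sum_divide_distrib)
  then have "(\<integral>\<^sup>+(x::real ^ 'n). ennreal (exp (- (1 / 2) * inner x x)) \<partial>lborel)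
      = (\<Prod>b\<in>(Basis :: (real ^ 'n) set). \<integral>\<^sup>+x. ennreal (exp (- (1 / 2) * x\<^sup>2)) \<partial>lborel)"
    by (simp only:) (rule nn_integral_lborel_prod, auto)
  also have "\<dots> = ennreal (sqrt (2 * pi) ^ CARD('n))"
    unfolding nn_integral_std_gaussian_real by (simp add: ennreal_power)
  also have "sqrt (2 * pi) ^ CARD('n) = (2 * pi) powr (real CARD('n) / 2)"
    by (simp add: powr_half_sqrt[symmetric] powr_realpow[symmetric] powr_powr)
  finally show ?thesis .
qed

lemma borel_measurable_gaussian [measurable]:
  "(\<lambda>u::real ^ 'n. exp (- (1 / 2) * inner (M *v u) u)) \<in> borel_measurable borel"
  by measurable

text \<open>
  If \<open>S\<^sup>* M S = 1\<close>, the substitution \<open>u = S v\<close> leads to the standard Gaussian, and taking determinants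
  gives both \<open>det M > 0\<close> and the Jacobian \<open>\<bar>det S\<bar> = 1 / sqrt (det M)\<close>.
\<close>

lemma pos_def_gaussian:
  fixes M :: "real ^ 'n ^ 'n"
  assumes M: "pos_def M"
  shows pos_def_det_pos: "det M > 0"
    and nn_integral_gaussian: "(\<integral>\<^sup>+u. ennreal (exp (- (1 / 2) * inner (M *v u) u)) \<partial>lborel)
      = ennreal ((2 * pi) powr (real CARD('n) / 2) / sqrt (det M))"
proof -
  obtain S :: "real ^ 'n ^ 'n" where S: "transpose S ** M ** S = mat 1"
    using pos_def_whitening[OF M] .
  have "det (transpose S ** M ** S) = 1" by (simp add: S)
  then have d: "det M * (det S)\<^sup>2 = 1"
    by (simp add: det_mul power2_eq_square algebra_simps)
  then have d0: "det S \<noteq> 0" by auto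
  have "det M = 1 / (det S)\<^sup>2"
    using d d0 by (simp add: field_simps)
  then show pos: "det M > 0"
    using d0 by simp
  have "(\<bar>det S\<bar>)\<^sup>2 = (1 / sqrt (det M))\<^sup>2"
    using d pos by (simp add: field_simps)
  then have dS: "\<bar>det S\<bar> = 1 / sqrt (det M)"
    using pos by (subst (asm) power2_eq_iff_nonneg) auto
  have Q: "inner (M *v (S *v u)) (S *v u) = inner u u" for u
  proof -
    have "inner (M *v (S *v u)) (S *v u) = inner (S *v u) (M *v (S *v u))"
      by (rule inner_commute)
    also have "\<dots> = inner u (transpose S *v (M *v (S *v u)))"
      by (rule inner_matrix_vector_mult_left)
    also have "\<dots> = inner u ((transpose S ** M ** S) *v u)"
      by (simp only: matrix_vector_mul_assoc matrix_mul_assoc)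
    finally show ?thesis by (simp add: S)
  qed
  have "(\<integral>\<^sup>+u. ennreal (exp (- (1 / 2) * inner (M *v u) u)) \<partial>lborel)
      = ennreal \<bar>det S\<bar> * (\<integral>\<^sup>+u. ennreal (exp (- (1 / 2) * inner (M *v (S *v u)) (S *v u))) \<partial>lborel)"
    by (rule nn_integral_lborel_matrix_substitution[OF _ d0]) measurable
  also have "\<dots> = ennreal (\<bar>det S\<bar> * (2 * pi) powr (real CARD('n) / 2))"
    unfolding Q nn_integral_std_gaussian by (simp add: ennreal_mult)
  finally show "(\<integral>\<^sup>+u. ennreal (exp (- (1 / 2) * inner (M *v u) u)) \<partial>lborel)
      = ennreal ((2 * pi) powr (real CARD('n) / 2) / sqrt (det M))"
    by (simp add: dS)
qed

lemma nn_integral_gaussian_affine: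
  fixes M F :: "real ^ 'n ^ 'n"
  assumes M: "pos_def M" and F: "\<bar>det F\<bar> = 1"
  shows "(\<integral>\<^sup>+z. ennreal (exp (- (1 / 2) * inner (M *v (w - F *v z)) (w - F *v z))) \<partial>lborel)
    = ennreal ((2 * pi) powr (real CARD('n) / 2) / sqrt (det M))"
proof -
  let ?g = "\<lambda>u. ennreal (exp (- (1 / 2) * inner (M *v u) u))"
  have "(\<integral>\<^sup>+u. ?g u \<partial>lborel) = (\<integral>\<^sup>+u. ?g u \<partial>distr lborel borel ((+) (- w)))"
    by (simp only: lborel_distr_plus)
  also have "\<dots> = (\<integral>\<^sup>+u. ?g (- w + u) \<partial>lborel)"
    by (rule nn_integral_distr) measurable
  also have "\<dots> = (\<integral>\<^sup>+u. ?g (w - u) \<partial>lborel)"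
  proof (rule nn_integral_cong)
    fix u
    have "M *v (w - u) = - (M *v (- w + u))"
      by (simp add: matrix_vector_mult_diff_distrib)
    then show "?g (- w + u) = ?g (w - u)"
      by (simp add: inner_diff_right inner_add_right)
  qed
  also have "\<dots> = ennreal \<bar>det F\<bar> * (\<integral>\<^sup>+z. ?g (w - F *v z) \<partial>lborel)"
    by (rule nn_integral_lborel_matrix_substitution) (use F in \<open>measurable, auto\<close>)
  finally show ?thesis
    unfolding nn_integral_gaussian[OF M] F by simp
qed

lemma pos_def_matrix_inv:
  fixes C :: "real ^ 'n ^ 'n"
  assumes C: "pos_def C"
  shows "pos_def (matrix_inv C)" and "det (matrix_inv C) = 1 / det C"
proof -
  have inv: "invertible C" using pos_def_det_pos[OF C] by (simp add: invertible_det_nz)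
  have CI: "C ** matrix_inv C = mat 1" and IC: "matrix_inv C ** C = mat 1"
    using someI_ex[OF inv[unfolded invertible_def]] unfolding matrix_inv_def by auto
  have "det C * det (matrix_inv C) = 1" using CI by (metis det_I det_mul)
  then show "det (matrix_inv C) = 1 / det C" by (metis nonzero_eq_divide_eq mult.commute mult_zero_left zero_neq_one)
  have "transpose (matrix_inv C) ** C = mat 1"
    using arg_cong[OF CI, of transpose] C by (simp add: matrix_transpose_mul transpose_mat pos_def_def)
  then have "transpose (matrix_inv C) ** (C ** matrix_inv C) = matrix_inv C"
    by (simp add: matrix_mul_assoc)
  then have sym: "transpose (matrix_inv C) = matrix_inv C" by (simp add: CI)
  have "inner (matrix_inv C *v u) u > 0" if "u \<noteq> 0" for u
  proof -
    define v where "v = matrix_inv C *v u"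
    have u: "u = C *v v" by (simp add: v_def matrix_vector_mul_assoc CI)
    have "v \<noteq> 0" using that u by auto
    then have "inner (C *v v) v > 0" using C by (simp add: pos_def_def)
    then have "inner v u > 0" by (metis inner_commute u)
    then show ?thesis by (simp add: v_def)
  qed
  then show "pos_def (matrix_inv C)" using sym by (simp add: pos_def_def)
qed

section \<open>The flow preserves volume\<close>

text \<open>
  Triangularity is expressed by a height function, so that no order on the index type is required. A
  permutation contributing to the determinant cannot raise the height anywhere; as it preserves the
  sum of all heights it preserves each of them, and is therefore the identity.
\<close>

lemma det_unitriangular:
  fixes F :: "real ^ 'n ^ 'n" and h :: "'n \<Rightarrow> nat"
  assumes diag: "\<And>i. F $ i $ i = 1"
    and tri: "\<And>i j. i \<noteq> j \<Longrightarrow> F $ i $ j \<noteq> 0 \<Longrightarrow> h j < h i"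
  shows "det F = 1"
proof -
  have "(\<Prod>i\<in>UNIV. F $ i $ p i) = 0" if p: "p permutes UNIV" and "p \<noteq> id" for p
  proof (rule ccontr)
    assume "(\<Prod>i\<in>UNIV. F $ i $ p i) \<noteq> 0"
    then have nz: "F $ i $ p i \<noteq> 0" for i by auto
    then have le: "h (p i) \<le> h i" for i
      using tri[of i "p i"] by (cases "p i = i") auto
    obtain k where k: "p k \<noteq> k" using \<open>p \<noteq> id\<close> by (auto simp: fun_eq_iff)
    then have "h (p k) < h k" using tri nz by metis
    then have "(\<Sum>i\<in>UNIV. h (p i)) < (\<Sum>i\<in>UNIV. h i)"
      by (intro sum_strict_mono_ex1) (use le in auto)
    moreover have "(\<Sum>i\<in>UNIV. h (p i)) = (\<Sum>i\<in>UNIV. h i)"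
      using sum.permute[OF p, of h] by (simp add: o_def)
    ultimately show False by simp
  qed
  then have "det F = (\<Sum>p\<in>{p. p permutes (UNIV :: 'n set)}. if p = id then 1 else 0)"
    unfolding Determinants.det_def by (intro sum.cong) (auto simp: diag sign_id)
  also have "\<dots> = 1"
    by (simp add: permutes_id)
  finally show ?thesis .
qed

lemma matrix_power_graded:
  fixes M :: "real ^ 'n ^ 'n" and h :: "'n \<Rightarrow> nat"
  assumes M: "\<And>i j. M $ i $ j \<noteq> 0 \<Longrightarrow> h i = Suc (h j)"
  shows "((**) M ^^ k) (mat 1) $ i $ j \<noteq> 0 \<Longrightarrow> h i = h j + k"
proof (induction k arbitrary: i)
  case 0
  then show ?case by (auto simp: mat_def split: if_splits)
next
  case (Suc k)
  have "(M ** P) $ i $ j = (\<Sum>l\<in>UNIV. M $ i $ l * P $ l $ j)" for P :: "real ^ 'n ^ 'n"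
    by (simp add: matrix_matrix_mult_def)
  then have "(\<Sum>l\<in>UNIV. M $ i $ l * (((**) M ^^ k) (mat 1)) $ l $ j) \<noteq> 0"
    using Suc.prems by (metis funpow.simps(2) comp_apply)
  then obtain l where "M $ i $ l * (((**) M ^^ k) (mat 1)) $ l $ j \<noteq> 0"
    by (meson sum.neutral)
  then show ?case using Suc.IH[of l] M[of i l] by auto
qed

text \<open>
  A matrix that raises the height by exactly 1 is nilpotent, so the exponential series is finite,
  and at most one of its terms contributes to a given entry.
\<close>

lemma matrix_exp_graded:
  fixes M :: "real ^ 'n ^ 'n" and h :: "'n \<Rightarrow> nat"
  assumes M: "\<And>i j. M $ i $ j \<noteq> 0 \<Longrightarrow> h i = Suc (h j)"
  shows "matrix_exp M $ i $ j
    = (if h j \<le> h i then (((**) M ^^ (h i - h j)) (mat 1)) $ i $ j / fact (h i - h j) else 0)"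
proof -
  let ?P = "\<lambda>k. ((**) M ^^ k) (mat 1)"
  \<comment> \<open>No difference of heights exceeds the maximal height, so later powers vanish.\<close>
  define K where "K = {..Max (range h)}"
  have "?P k = 0" if "k \<notin> K" for k
  proof -
    have "h i \<le> Max (range h)" for i by simp
    then have "h i \<noteq> h j + k" for i j
      using that by (metis K_def atMost_iff le_add2 order.trans)
    then show ?thesis
      using matrix_power_graded[of M h, OF M] by (metis vec_eq_iff zero_index)
  qed
  then have "matrix_exp M = (\<Sum>k\<in>K. (1 / fact k) *\<^sub>R ?P k)"
    unfolding matrix_exp_def by (intro suminf_finite) (auto simp: K_def)
  then have "matrix_exp M $ i $ j = (\<Sum>k\<in>K. (1 / fact k) * ?P k $ i $ j)"
    by simp
  also have "\<dots> = (\<Sum>k\<in>K. if k = h i - h j then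
      (if h j \<le> h i then ?P (h i - h j) $ i $ j / fact (h i - h j) else 0) else 0)"
  proof (intro sum.cong refl)
    fix k
    show "(1 / fact k) * ?P k $ i $ j = (if k = h i - h j then
      (if h j \<le> h i then ?P (h i - h j) $ i $ j / fact (h i - h j) else 0) else 0)"
    proof (cases "h i = h j + k")
      case False
      then have "?P k $ i $ j = 0" using matrix_power_graded[of M h, OF M] by blast
      with False show ?thesis by auto
    qed simp
  qed
  also have "h i - h j \<in> K"
    by (simp add: K_def order.trans[OF diff_le_self])
  then have "(\<Sum>k\<in>K. if k = h i - h j then
      (if h j \<le> h i then ?P (h i - h j) $ i $ j / fact (h i - h j) else 0) else 0)
      = (if h j \<le> h i then ?P (h i - h j) $ i $ j / fact (h i - h j) else 0)"
    by (simp add: K_def)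
  finally show ?thesis .
qed

lemma det_flow_matrix_drift:
  "det (flow_matrix (drift_matrix l Bs) t) = 1"
proof -
  define M where "M = (- t) *\<^sub>R transpose (drift_matrix l Bs)"
  have M: "fst (l i) = Suc (fst (l j))" if "M $ i $ j \<noteq> 0" for i j
    using that by (auto simp: M_def transpose_def drift_matrix_def split: if_splits)
  have E: "matrix_exp M $ i $ j = (if fst (l j) \<le> fst (l i)
      then (((**) M ^^ (fst (l i) - fst (l j))) (mat 1)) $ i $ j / fact (fst (l i) - fst (l j)) else 0)" for i j
    by (rule matrix_exp_graded[where h = "\<lambda>i. fst (l i)"]) (rule M)
  show ?thesis
    unfolding flow_matrix_def M_def[symmetric]
  proof (rule det_unitriangular[where h = "\<lambda>i. fst (l i)"])
    show "matrix_exp M $ i $ i = 1" for i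
      unfolding E by (simp add: mat_def)
    show "fst (l j) < fst (l i)" if "i \<noteq> j" "matrix_exp M $ i $ j \<noteq> 0" for i j
      using that unfolding E by (auto simp: mat_def le_less split: if_splits)
  qed
qed

section \<open>The covariance matrix\<close>

lemma pos_semidef_congruence:
  fixes A F :: "real ^ 'n ^ 'n"
  assumes "pos_semidef A"
  shows "pos_semidef (F ** A ** transpose F)"
proof -
  have "transpose (F ** A ** transpose F) = F ** A ** transpose F"
    using assms by (simp add: pos_semidef_def matrix_transpose_mul matrix_mul_assoc)
  moreover have "inner ((F ** A ** transpose F) *v u) u = inner (A *v (transpose F *v u)) (transpose F *v u)" for u
    by (simp add: matrix_vector_mul_assoc[symmetric] inner_matrix_vector_mult_left)
  ultimately show ?thesis
    using assms by (simp add: pos_semidef_def)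
qed

text \<open>
  Transposition and \<open>X \<mapsto> \<langle>X u, u\<rangle>\<close> are linear and so commute with the integral. If \<open>G\<close> is not
  integrable, its integral is 0 by convention, which is positive semidefinite as well.
\<close>

lemma pos_semidef_integral:
  fixes G :: "real \<Rightarrow> real ^ 'n ^ 'n"
  assumes G: "\<And>s. s \<in> S \<Longrightarrow> pos_semidef (G s)"
  shows "pos_semidef (integral S G)"
proof (cases "G integrable_on S")
  case False
  then show ?thesis
    by (simp add: not_integrable_integral pos_semidef_def) (simp add: transpose_def vec_eq_iff)
next
  case True
  have lt: "bounded_linear (transpose :: real ^ 'n ^ 'n \<Rightarrow> _)"
    by (intro linear_conv_bounded_linear[THEN iffD1] linearI)
       (simp_all add: transpose_def vec_eq_iff)
  have "transpose (integral S G) = integral S (transpose \<circ> G)"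
    by (rule integral_linear[OF True lt, symmetric])
  also have "\<dots> = integral S G"
    using G by (intro integral_cong) (simp add: pos_semidef_def)
  finally have sym: "transpose (integral S G) = integral S G" .
  have "inner (integral S G *v u) u \<ge> 0" for u
  proof -
    have lq: "bounded_linear (\<lambda>X :: real ^ 'n ^ 'n. inner (X *v u) u)"
      by (intro linear_conv_bounded_linear[THEN iffD1] linearI)
         (simp_all add: matrix_vector_mult_add_rdistrib inner_add_left scaleR_matrix_vector_assoc[symmetric])
    have "inner (integral S G *v u) u = integral S ((\<lambda>X. inner (X *v u) u) \<circ> G)"
      by (rule integral_linear[OF True lq, symmetric])
    also have "\<dots> \<ge> 0"
      using G by (intro integral_nonneg integrable_linear[OF True lq]) (simp add: pos_semidef_def)
    finally show ?thesis .
  qed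
  with sym show ?thesis by (simp add: pos_semidef_def)
qed

lemma pos_semidef_diffusion_matrix:
  fixes l :: "'n::finite \<Rightarrow> nat \<times> nat"
  assumes A0: "sym_pos_def (m 0) A0" and l: "block_labelling r m l"
  shows "pos_semidef (diffusion_matrix l A0)"
proof -
  have bij: "bij_betw l UNIV (SIGMA k:{..r}. {..<m k})"
    using l by (simp add: block_labelling_def)
  have carr: "A0 \<in> carrier_mat (m 0) (m 0)" and symA: "transpose_mat A0 = A0"
    and pos: "\<And>v. v \<in> carrier_vec (m 0) \<Longrightarrow> v \<noteq> 0\<^sub>v (m 0) \<Longrightarrow> scalar_prod v (A0 *\<^sub>v v) > 0"
    using A0 by (auto simp: sym_pos_def_def)
  define I where "I = {i. fst (l i) = 0}"
  have lt: "snd (l i) < m 0" if "i \<in> I" for i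
  proof -
    have "l i \<in> (SIGMA k:{..r}. {..<m k})" using bij by (auto simp: bij_betw_def)
    then show ?thesis using that by (auto simp: I_def)
  qed
  have bI: "bij_betw (\<lambda>i. snd (l i)) I {..<m 0}"
  proof (rule bij_betw_imageI)
    show "inj_on (\<lambda>i. snd (l i)) I"
      using bij by (auto simp: inj_on_def I_def bij_betw_def prod_eq_iff)
    show "(\<lambda>i. snd (l i)) ` I = {..<m 0}"
    proof (intro equalityI subsetI)
      fix a assume "a \<in> {..<m 0}"
      then have "(0, a) \<in> range l" using bij by (auto simp: bij_betw_def)
      then obtain i where "l i = (0, a)" by (metis rangeE)
      then show "a \<in> (\<lambda>i. snd (l i)) ` I" by (auto simp: I_def image_iff intro!: exI[of _ i])
    qed (use lt in auto)
  qed
  have "diffusion_matrix l A0 $ i $ j = diffusion_matrix l A0 $ j $ i" for i j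
  proof (cases "i \<in> I \<and> j \<in> I")
    case True
    then have "transpose_mat A0 $$ (snd (l i), snd (l j)) = A0 $$ (snd (l j), snd (l i))"
      using carr lt by (intro index_transpose_mat) auto
    with True show ?thesis by (simp add: symA diffusion_matrix_def I_def)
  qed (auto simp: diffusion_matrix_def I_def)
  then have "transpose (diffusion_matrix l A0) = diffusion_matrix l A0"
    by (simp add: transpose_def vec_eq_iff)
  moreover have "inner (diffusion_matrix l A0 *v u) u \<ge> 0" for u
  proof -
    \<comment> \<open>The part of \<open>u\<close> in block 0, as a vector on which \<open>A0\<close> acts.\<close>
    define w where "w = Matrix.vec (m 0) (\<lambda>a. u $ inv_into I (\<lambda>i. snd (l i)) a)"
    have w: "w \<in> carrier_vec (m 0)" by (simp add: w_def)
    have wl: "vec_index w (snd (l i)) = u $ i" if "i \<in> I" for i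
      using that lt bI by (simp add: w_def bij_betw_def inv_into_f_f[of "\<lambda>i. snd (l i)"])
    have "inner (diffusion_matrix l A0 *v u) u
        = (\<Sum>i\<in>UNIV. \<Sum>j\<in>UNIV. if i \<in> I \<and> j \<in> I then u $ i * (A0 $$ (snd (l i), snd (l j)) * u $ j) else 0)"
      unfolding inner_vec_def matrix_vector_mult_def diffusion_matrix_def I_def
      by (auto simp: sum_distrib_right intro!: sum.cong)
    also have "\<dots> = (\<Sum>i\<in>I. \<Sum>j\<in>I. u $ i * (A0 $$ (snd (l i), snd (l j)) * u $ j))"
    proof -
      have restrict: "(\<Sum>j\<in>UNIV. if i \<in> I \<and> j \<in> I then h j else 0) = (if i \<in> I then \<Sum>j\<in>I. h j else 0)"
        for i and h :: "'n \<Rightarrow> real"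
        by (simp add: sum.If_cases)
      show ?thesis unfolding restrict by (simp add: sum.If_cases)
    qed
    also have "\<dots> = (\<Sum>i\<in>I. \<Sum>j\<in>I. vec_index w (snd (l i)) * (A0 $$ (snd (l i), snd (l j)) * vec_index w (snd (l j))))"
      by (intro sum.cong) (simp_all add: wl)
    also have "\<dots> = (\<Sum>i\<in>I. \<Sum>b\<in>{..<m 0}. vec_index w (snd (l i)) * (A0 $$ (snd (l i), b) * vec_index w b))"
      by (intro sum.cong refl sum.reindex_bij_betw[OF bI])
    also have "\<dots> = (\<Sum>a\<in>{..<m 0}. \<Sum>b\<in>{..<m 0}. vec_index w a * (A0 $$ (a, b) * vec_index w b))"
      by (rule sum.reindex_bij_betw[OF bI])
    also have "\<dots> = scalar_prod w (A0 *\<^sub>v w)"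
      using carr w by (simp add: scalar_prod_def mult_mat_vec_def sum_distrib_left atLeast0LessThan)
    also have "\<dots> \<ge> 0"
      using pos[OF w] carr w by (cases "w = 0\<^sub>v (m 0)") (auto intro: less_imp_le)
    finally show ?thesis .
  qed
  ultimately show ?thesis by (simp add: pos_semidef_def)
qed

lemma pos_semidef_cov_matrix:
  assumes "pos_semidef A"
  shows "pos_semidef (cov_matrix A B t)"
  unfolding cov_matrix_def by (intro pos_semidef_integral pos_semidef_congruence assms)

section \<open>Hoelder's inequality\<close>

text \<open>
  Young's inequality is applied pointwise, after both factors have been normalised in \<open>L\<^sup>p\<close> and
  \<open>L\<^sup>q\<close>. If one of the norms is 0, the product vanishes almost everywhere.
\<close>

lemma Hoelder_inequality:
  fixes u v :: "'a \<Rightarrow> real"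
  assumes p: "p > 1" and q: "q > 1" and pq: "1 / p + 1 / q = 1"
    and [measurable]: "u \<in> borel_measurable M" "v \<in> borel_measurable M"
    and u: "\<And>z. 0 \<le> u z" and v: "\<And>z. 0 \<le> v z"
    and up: "integrable M (\<lambda>z. u z powr p)" and vq: "integrable M (\<lambda>z. v z powr q)"
  shows "(\<integral>z. u z * v z \<partial>M) \<le> (\<integral>z. u z powr p \<partial>M) powr (1 / p) * (\<integral>z. v z powr q \<partial>M) powr (1 / q)"
proof -
  define a where "a = (\<integral>z. u z powr p \<partial>M)"
  define b where "b = (\<integral>z. v z powr q \<partial>M)"
  have nn: "a \<ge> 0" "b \<ge> 0" by (simp_all add: a_def b_def)
  show ?thesis
  proof (cases "a = 0 \<or> b = 0")
    case True
    have "AE z in M. u z * v z = 0"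
      using True
    proof
      assume "a = 0"
      then have "AE z in M. u z powr p = 0"
        using integral_nonneg_eq_0_iff_AE[OF up] by (simp add: a_def)
      then show ?thesis by eventually_elim simp
    next
      assume "b = 0"
      then have "AE z in M. v z powr q = 0"
        using integral_nonneg_eq_0_iff_AE[OF vq] by (simp add: b_def)
      then show ?thesis by eventually_elim simp
    qed
    then have "(\<integral>z. u z * v z \<partial>M) = 0" by (simp add: integral_eq_zero_AE)
    then show ?thesis by simp
  next
    case False
    with nn have a: "a > 0" and b: "b > 0" by auto
    define c where "c = a powr (1 / p) * b powr (1 / q)"
    have c: "c > 0" using a b by (simp add: c_def)
    have pt: "u z * v z \<le> c * (u z powr p / (a * p) + v z powr q / (b * q))" for z
    proof -
      have "(u z / a powr (1 / p)) * (v z / b powr (1 / q))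
          \<le> (u z / a powr (1 / p)) powr p / p + (v z / b powr (1 / q)) powr q / q"
        using p q pq u v by (intro Youngs_inequality) auto
      also have "\<dots> = u z powr p / (a * p) + v z powr q / (b * q)"
        using p q a b u v by (simp add: powr_divide powr_powr)
      finally have "(u z * v z) / c \<le> u z powr p / (a * p) + v z powr q / (b * q)"
        by (simp add: c_def)
      then show ?thesis using c by (simp add: divide_le_eq mult.commute)
    qed
    have int: "integrable M (\<lambda>z. c * (u z powr p / (a * p) + v z powr q / (b * q)))"
      using up vq by simp
    have "integrable M (\<lambda>z. u z * v z)"
      by (rule Bochner_Integration.integrable_bound[OF int])
         (use pt u v in \<open>auto intro!: AE_I2 order.trans[OF _ abs_ge_self]\<close>)
    then have "(\<integral>z. u z * v z \<partial>M) \<le> (\<integral>z. c * (u z powr p / (a * p) + v z powr q / (b * q)) \<partial>M)"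
      by (intro integral_mono int pt)
    also have "\<dots> = c * (a / (a * p) + b / (b * q))"
      using up vq by (simp add: a_def b_def)
    also have "\<dots> = c" using a b pq by simp
    finally show ?thesis by (simp add: c_def a_def b_def)
  qed
qed

section \<open>The Gaussian kernel\<close>

text \<open>
  Completing the square with affine weights. The remainder depends on \<open>b - a\<close> only: for
  \<open>a = x - E z\<close> and \<open>b = y - E z\<close> it does not involve \<open>z\<close> and leaves the integral as a constant.
\<close>

lemma quadratic_form_interpolation:
  fixes M :: "real ^ 'n ^ 'n"
  assumes sym: "transpose M = M"
  shows "q * inner (M *v a) a + (1 - q) * inner (M *v b) b
    = inner (M *v (q *\<^sub>R a + (1 - q) *\<^sub>R b)) (q *\<^sub>R a + (1 - q) *\<^sub>R b)
      - q * (q - 1) * inner (M *v (b - a)) (b - a)"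
proof -
  have "inner (M *v b) a = inner (M *v a) b"
    by (metis inner_matrix_vector_mult_left sym inner_commute)
  then show ?thesis
    by (simp add: matrix_vector_right_distrib matrix_vector_mult_diff_distrib
        matrix_vector_mult_scaleR inner_add_left inner_add_right inner_diff_left inner_diff_right)
       (simp add: algebra_simps)
qed

lemma gauss_kernel_pos:
  assumes "pos_def (cov_matrix A B t)"
  shows "gauss_kernel A B u t > 0"
  using pos_def_det_pos[OF assms] by (simp add: gauss_kernel_def)

lemma borel_measurable_gauss_kernel [measurable]:
  "(\<lambda>u. gauss_kernel A B u t) \<in> borel_measurable borel"
  unfolding gauss_kernel_def by measurable

text \<open>
  The normalising constant of the kernel occurs to the total power \<open>q + (1 - q) = 1\<close>, so what is
  left beside the constant from completing the square is again a correctly normalised kernel.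
\<close>

lemma gauss_kernel_powr_interpolation:
  fixes A B :: "real ^ 'n ^ 'n"
  assumes C: "pos_def (cov_matrix A B t)"
  shows "gauss_kernel A B a t powr q * gauss_kernel A B b t powr (1 - q)
    = exp (q * (q - 1) / 2 * inner (matrix_inv (cov_matrix A B t) *v (b - a)) (b - a))
      * gauss_kernel A B (q *\<^sub>R a + (1 - q) *\<^sub>R b) t"
proof -
  define M where "M = matrix_inv (cov_matrix A B t)"
  have M: "transpose M = M"
    using pos_def_matrix_inv(1)[OF C] by (simp add: pos_def_def M_def)
  define c where "c = (2 * pi) powr (- (real CARD('n) / 2)) / sqrt (det (cov_matrix A B t))"
  have c: "c > 0" using pos_def_det_pos[OF C] by (simp add: c_def)
  have k: "gauss_kernel A B u t = c * exp (- (1 / 2) * inner (M *v u) u)" for u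
    by (simp add: gauss_kernel_def c_def M_def)
  have kp: "gauss_kernel A B u t powr s = c powr s * exp (s * (- (1 / 2) * inner (M *v u) u))" for u s
    unfolding k using c by (subst powr_mult) (auto simp: powr_def[of "exp _"])
  have "gauss_kernel A B a t powr q * gauss_kernel A B b t powr (1 - q)
      = (c powr q * c powr (1 - q))
        * (exp (q * (- (1 / 2) * inner (M *v a) a)) * exp ((1 - q) * (- (1 / 2) * inner (M *v b) b)))"
    unfolding kp by (simp only: mult_ac)
  also have "\<dots> = c * exp (- (1 / 2) * (q * inner (M *v a) a + (1 - q) * inner (M *v b) b))"
    using c by (simp add: powr_add[symmetric] exp_add[symmetric] field_simps)
  also have "\<dots> = c * (exp (q * (q - 1) / 2 * inner (M *v (b - a)) (b - a))
      * exp (- (1 / 2) * inner (M *v (q *\<^sub>R a + (1 - q) *\<^sub>R b)) (q *\<^sub>R a + (1 - q) *\<^sub>R b)))"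
  proof -
    have "- (1 / 2) * (X - q * (q - 1) * R) = q * (q - 1) / 2 * R + - (1 / 2) * X" for X R :: real
      by (simp add: field_simps)
    then show ?thesis
      unfolding quadratic_form_interpolation[OF M] exp_add[symmetric] by simp
  qed
  finally show ?thesis unfolding k M_def by (simp only: mult_ac)
qed

lemma gauss_kernel_integral_eq_1:
  fixes A B F :: "real ^ 'n ^ 'n"
  assumes C: "pos_def (cov_matrix A B t)" and F: "\<bar>det F\<bar> = 1"
  shows "integrable lborel (\<lambda>z. gauss_kernel A B (w - F *v z) t)"
    and "(\<integral>z. gauss_kernel A B (w - F *v z) t \<partial>lborel) = 1"
proof -
  define D where "D = det (cov_matrix A B t)"
  have D: "D > 0" using pos_def_det_pos[OF C] by (simp add: D_def)
  define c where "c = (2 * pi) powr (- (real CARD('n) / 2)) / sqrt D"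
  have c: "c > 0" using D by (simp add: c_def)
  define M where "M = matrix_inv (cov_matrix A B t)"
  have M: "pos_def M" and dM: "det M = 1 / D"
    using pos_def_matrix_inv[OF C] by (auto simp: M_def D_def)
  have "(\<integral>\<^sup>+z. ennreal (gauss_kernel A B (w - F *v z) t) \<partial>lborel)
      = (\<integral>\<^sup>+z. ennreal c * ennreal (exp (- (1 / 2) * inner (M *v (w - F *v z)) (w - F *v z))) \<partial>lborel)"
    using c by (intro nn_integral_cong) (simp add: gauss_kernel_def c_def D_def M_def ennreal_mult[symmetric])
  also have "\<dots> = ennreal c * ennreal ((2 * pi) powr (real CARD('n) / 2) / sqrt (det M))"
    by (subst nn_integral_cmult) (measurable, simp only: nn_integral_gaussian_affine[OF M F])
  also have "\<dots> = ennreal (c * ((2 * pi) powr (real CARD('n) / 2) / sqrt (det M)))"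
    using c by (intro ennreal_mult[symmetric]) (auto simp: dM D less_imp_le)
  also have "c * ((2 * pi) powr (real CARD('n) / 2) / sqrt (det M)) = 1"
    using D by (simp add: c_def dM real_sqrt_divide powr_minus)
  finally have "(\<integral>\<^sup>+z. ennreal (gauss_kernel A B (w - F *v z) t) \<partial>lborel) = ennreal 1" .
  then have "has_bochner_integral lborel (\<lambda>z. gauss_kernel A B (w - F *v z) t) 1"
    by (intro has_bochner_integral_nn_integral) (auto simp: less_imp_le[OF gauss_kernel_pos[OF C]])
  then show "integrable lborel (\<lambda>z. gauss_kernel A B (w - F *v z) t)"
    and "(\<integral>z. gauss_kernel A B (w - F *v z) t \<partial>lborel) = 1"
    by (auto simp: has_bochner_integral_iff)
qed

text \<open>
  The two properties of the semigroup that the inequality rests on are a positive definite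
  covariance matrix and a volume preserving flow; together they make every kernel a probability density.
\<close>

lemma semigroup_op_Harnack:
  fixes A B :: "real ^ 'n ^ 'n" and f :: "real ^ 'n \<Rightarrow> real"
  assumes C: "pos_def (cov_matrix A B t)" and F: "\<bar>det (flow_matrix B t)\<bar> = 1"
    and f [measurable]: "f \<in> borel_measurable borel" and bdd: "bounded (range f)" and nn: "\<And>z. 0 \<le> f z"
    and \<alpha>: "\<alpha> > 1"
  shows "semigroup_op A B t f x powr \<alpha>
    \<le> exp (\<alpha> / (2 * (\<alpha> - 1)) * inner (matrix_inv (cov_matrix A B t) *v (y - x)) (y - x))
      * semigroup_op A B t (\<lambda>z. f z powr \<alpha>) y"
proof -
  define k where "k w z = gauss_kernel A B (w - flow_matrix B t *v z) t" for w z
  define Q where "Q = inner (matrix_inv (cov_matrix A B t) *v (y - x)) (y - x)"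
  define q where "q = \<alpha> / (\<alpha> - 1)"
  have q: "q > 1" and pq: "1 / \<alpha> + 1 / q = 1"
    using \<alpha> by (auto simp: q_def field_simps)
  have k_pos: "k w z > 0" for w z
    unfolding k_def by (rule gauss_kernel_pos[OF C])
  have [measurable]: "k w \<in> borel_measurable borel" for w
    unfolding k_def by measurable
  have k_int: "integrable lborel (k w)" and k_one: "(\<integral>z. k w z \<partial>lborel) = 1" for w
    using gauss_kernel_integral_eq_1[OF C F, of w] by (auto simp: k_def[abs_def])
  define u where "u z = k y z powr (1 / \<alpha>) * f z" for z
  define v where "v z = k x z * k y z powr (- (1 / \<alpha>))" for z
  have uv: "u z * v z = k x z * f z" for z
    using k_pos[of y z] by (simp add: u_def v_def powr_minus field_simps)
  have up: "u z powr \<alpha> = k y z * f z powr \<alpha>" for z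
    using k_pos[of y z] nn[of z] \<alpha> by (simp add: u_def powr_mult powr_powr)
  \<comment> \<open>The centre of the Gaussian obtained by completing the square; it lies on the line through
    \<open>x\<close> and \<open>y\<close>, beyond \<open>x\<close>.\<close>
  define w where "w = q *\<^sub>R x + (1 - q) *\<^sub>R y"
  have vq: "v z powr q = exp (q * (q - 1) / 2 * Q) * k w z" for z
  proof -
    have "v z powr q = k x z powr q * k y z powr (1 - q)"
    proof -
      have "- (1 / \<alpha>) * q = 1 - q" using \<alpha> by (simp add: q_def field_simps)
      then show ?thesis
        using k_pos[of x z] k_pos[of y z] unfolding v_def
        by (subst powr_mult) (auto simp: powr_powr)
    qed
    also have "\<dots> = exp (q * (q - 1) / 2 * Q) * k w z"
    proof -
      let ?F = "flow_matrix B t *v z"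
      have 1: "(y - ?F) - (x - ?F) = y - x" by simp
      have 2: "q *\<^sub>R (x - ?F) + (1 - q) *\<^sub>R (y - ?F) = w - ?F"
        by (simp add: w_def algebra_simps)
      show ?thesis
        using gauss_kernel_powr_interpolation[OF C, of "x - ?F" q "y - ?F"]
        unfolding 1 2 k_def Q_def .
    qed
    finally show ?thesis .
  qed
  obtain K where K: "\<And>z. f z \<le> K"
    using bdd by (auto simp: bounded_iff) (meson abs_le_D1)
  have up_int: "integrable lborel (\<lambda>z. u z powr \<alpha>)"
  proof (rule Bochner_Integration.integrable_bound)
    show "integrable lborel (\<lambda>z. K powr \<alpha> * k y z)" using k_int by simp
    show "AE z in lborel. norm (u z powr \<alpha>) \<le> norm (K powr \<alpha> * k y z)"
      using k_pos nn K \<alpha>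
      by (intro AE_I2) (simp add: up abs_mult less_imp_le powr_mono2 mult.commute mult_left_mono)
  qed (simp add: up)
  have vq_int: "integrable lborel (\<lambda>z. v z powr q)" using k_int by (simp add: vq)
  have [measurable]: "u \<in> borel_measurable lborel" "v \<in> borel_measurable lborel"
    unfolding u_def v_def by measurable
  define I where "I = (\<integral>z. u z powr \<alpha> \<partial>lborel)"
  define J where "J = (\<integral>z. v z powr q \<partial>lborel)"
  have I: "I = semigroup_op A B t (\<lambda>z. f z powr \<alpha>) y"
    by (simp add: I_def up semigroup_op_def k_def)
  have J: "J = exp (q * (q - 1) / 2 * Q)"
    by (simp add: J_def vq k_one)
  have I0: "I \<ge> 0" by (simp add: I_def)
  have P: "semigroup_op A B t f x = (\<integral>z. u z * v z \<partial>lborel)"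
    by (simp add: uv semigroup_op_def k_def)
  have P0: "semigroup_op A B t f x \<ge> 0"
    unfolding P uv using k_pos nn by (intro integral_nonneg_AE AE_I2) (simp add: less_imp_le)
  have "semigroup_op A B t f x \<le> I powr (1 / \<alpha>) * J powr (1 / q)"
    unfolding P I_def J_def
    by (rule Hoelder_inequality[OF \<alpha> q pq _ _ _ _ up_int vq_int])
       (use k_pos nn in \<open>auto simp: u_def v_def less_imp_le\<close>)
  then have "semigroup_op A B t f x powr \<alpha> \<le> (I powr (1 / \<alpha>) * J powr (1 / q)) powr \<alpha>"
    using P0 \<alpha> by (intro powr_mono2) auto
  also have "\<dots> = I * J powr (\<alpha> / q)"
    using I0 \<alpha> by (simp add: powr_mult powr_powr J)
  also have "J powr (\<alpha> / q) = exp (\<alpha> / q * (q * (q - 1) / 2 * Q))"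
    by (simp add: J powr_def)
  also have "\<alpha> / q * (q * (q - 1) / 2 * Q) = \<alpha> / (2 * (\<alpha> - 1)) * Q"
  proof -
    have "q - 1 = 1 / (\<alpha> - 1)" using \<alpha> by (simp add: q_def field_simps)
    then show ?thesis using q by simp
  qed
  finally show ?thesis by (simp add: I Q_def mult.commute)
qed

theorem theorem3p3:
  fixes r :: nat and m :: "nat \<Rightarrow> nat"
    and A0 :: "real Matrix.mat" and Bs :: "nat \<Rightarrow> real Matrix.mat"
    and l :: "'n::finite \<Rightarrow> nat \<times> nat"
    and A B :: "real ^ 'n ^ 'n"
    and f :: "real ^ 'n \<Rightarrow> real"
    and t \<alpha> :: real and x y :: "real ^ 'n"
  assumes "r \<ge> 1"
    and "\<And>k. k < r \<Longrightarrow> m (Suc k) \<le> m k" and "m r \<ge> 1"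
    and "sym_pos_def (m 0) A0"
    and "\<And>k. 1 \<le> k \<Longrightarrow> k \<le> r \<Longrightarrow> Bs k \<in> carrier_mat (m (k - 1)) (m k)"
    and "\<And>k. 1 \<le> k \<Longrightarrow> k \<le> r \<Longrightarrow> vec_space.rank (m (k - 1)) (Bs k) = m k"
    and "block_labelling r m l"
    and "A = diffusion_matrix l A0" and "B = drift_matrix l Bs"
    and "f \<in> borel_measurable borel" and "bounded (range f)" and "\<And>z. 0 \<le> f z"
    and "t > 0" and "\<alpha> > 1"
  shows "semigroup_op A B t f x powr \<alpha>
    \<le> exp (\<alpha> / (2 * (\<alpha> - 1)) * inner (matrix_inv (cov_matrix A B t) *v (y - x)) (y - x))
      * semigroup_op A B t (\<lambda>z. f z powr \<alpha>) y"
proof (cases "det (cov_matrix A B t) = 0")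
  case True
  \<comment> \<open>The normalising factor of the kernel is \<open>1 / sqrt 0\<close>, that is, 0.\<close>
  then have "gauss_kernel A B u t = 0" for u
    by (simp add: gauss_kernel_def)
  then show ?thesis by (simp add: semigroup_op_def)
next
  case False
  have "pos_semidef (cov_matrix A B t)"
    unfolding \<open>A = _\<close>
    by (rule pos_semidef_cov_matrix[OF pos_semidef_diffusion_matrix])
       (fact \<open>sym_pos_def (m 0) A0\<close> \<open>block_labelling r m l\<close>)+
  then have "pos_def (cov_matrix A B t)"
    using False by (rule pos_semidef_nonsingular_imp_pos_def)
  moreover have "\<bar>det (flow_matrix B t)\<bar> = 1"
    by (simp add: \<open>B = _\<close> det_flow_matrix_drift)
  ultimately show ?thesis
    by (rule semigroup_op_Harnack) fact+
qed

end
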